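(* For sequences of items all of size zero, with an arbitrary number of colors, the online algorithm Balancing Any Fit (BAF) uses at most $\lceil 1.5\cdot \mathrm{OPT}\rceil$ bins on every input sequence; in particular it is $1.5$-competitive.
   Context: Colored Bin Packing: items arrive as a sequence; each item has a size in $[0,1]$ and a color from a finite set $C$. A packing places items into unit-capacity bins, items in a bin ordered by arrival; it is valid if each bin has total size at most $1$ and no two consecutive items in a bin share a color. $\mathrm{OPT}$ is the minimum number of bins in a valid packing without reordering. The top item of a bin is its last item; a $c$-bin is a bin whose top item has color $c$; a $c$-item is an item of color $c$. Definitions used by BAF, evaluated just before the incoming item is packed (items so far indexed $1,\dots,k$): $s_{c,\ell}=1$ if item $\ell$ has color $c$ and $-1$ otherwise; $D=\max_{c}\max_{1\le i\le j\le k}\sum_{\ell=i}^j s_{c,\ell}$ is the maximal discrepancy so far; $N_c$ is the current number of $c$-bins; $\mathrm{CD}_c=\max_{i\le k+1}\sum_{\ell=i}^{k}s_{c,\ell}$ (the empty sum is $0$) is the current discrepancy of color $c$. BAF, for an incoming $c$-item: (1) If there are no bins or all bins are $c$-bins, open a new bin and put the item into it. (2) Otherwise, if there is at most one color $c''$ with $N_{c''} > \lceil D/2\rceil$, put the item into a bin of a color $c'\neq c$ maximizing $N_{c'}$ over colors different from $c$ (ties and the choice of bin broken arbitrarily). (3) Otherwise there are two colors $b,w$ with $N_b>\lceil D/2\rceil$ and $N_w>\lceil D/2\rceil$: if $c=w$ put the item into a $b$-bin; if $c=b$ put it into a $w$-bin; if $c\notin\{b,w\}$, put it into a $w$-bin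 if $N_b-\lceil D/2\rceil<\mathrm{CD}_b$ and into a $b$-bin otherwise. *)

theory Defs
  imports Complex_Main
begin

datatype 'c item = Item (item_size: real) (color: 'c)

definition cbp_input :: "'c set \<Rightarrow> 'c item list \<Rightarrow> bool" where
  "cbp_input C xs \<longleftrightarrow> finite C \<and> (\<forall>x\<in>set xs. color x \<in> C \<and> 0 \<le> item_size x \<and> item_size x \<le> 1)"

definition zero_size_input :: "'c set \<Rightarrow> 'c item list \<Rightarrow> bool" where
  "zero_size_input C xs \<longleftrightarrow> cbp_input C xs \<and> (\<forall>x\<in>set xs. item_size x = 0)"

text \<open>
  Items are listed in order of arrival. A packing of \<open>xs\<close> is a list \<open>p\<close> of the same length, where
  \<open>p ! i\<close> is the name of the bin that receives item \<open>xs ! i\<close>. The (nonempty) bins are the elements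
  of \<open>set p\<close>, and the content of a bin is listed in order of arrival, bottom item first.
\<close>

definition bin_content :: "'c item list \<Rightarrow> nat list \<Rightarrow> nat \<Rightarrow> 'c item list" where
  "bin_content xs p b = map fst (filter (\<lambda>(x, d). d = b) (zip xs p))"

definition num_bins :: "nat list \<Rightarrow> nat" where
  "num_bins p = card (set p)"

definition valid_packing :: "'c item list \<Rightarrow> nat list \<Rightarrow> bool" where
  "valid_packing xs p \<longleftrightarrow> length p = length xs \<and>
     (\<forall>b\<in>set p. (\<Sum>x\<leftarrow>bin_content xs p b. item_size x) \<le> 1 \<and>
                successively (\<lambda>x y. color x \<noteq> color y) (bin_content xs p b))"

definition opt :: "'c item list \<Rightarrow> nat" where
  "opt xs = (LEAST n. \<exists>p. valid_packing xs p \<and> num_bins p = n)"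

definition top_item :: "'c item list \<Rightarrow> nat list \<Rightarrow> nat \<Rightarrow> 'c item" where
  "top_item xs p b = last (bin_content xs p b)"

definition c_bins :: "'c item list \<Rightarrow> nat list \<Rightarrow> 'c \<Rightarrow> nat set" where
  "c_bins xs p c = {b \<in> set p. color (top_item xs p b) = c}"

definition num_c_bins :: "'c item list \<Rightarrow> nat list \<Rightarrow> 'c \<Rightarrow> nat" where
  "num_c_bins xs p c = card (c_bins xs p c)"

text \<open>
  Item indices are zero-based below. The maximum in \<open>max_disc\<close> ranges over the empty set if there
  are no items yet, but in that case the algorithm opens a bin without consulting it.
\<close>

definition disc_sign :: "'c item list \<Rightarrow> 'c \<Rightarrow> nat \<Rightarrow> int" where
  "disc_sign xs c l = (if color (xs ! l) = c then 1 else -1)"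

definition max_disc :: "'c set \<Rightarrow> 'c item list \<Rightarrow> int" where
  "max_disc C xs = Max {(\<Sum>l=i..j. disc_sign xs c l) | c i j. c \<in> C \<and> i \<le> j \<and> j < length xs}"

definition cur_disc :: "'c item list \<Rightarrow> 'c \<Rightarrow> int" where
  "cur_disc xs c = Max {(\<Sum>l=i..<length xs. disc_sign xs c l) | i. i \<le> length xs}"

definition half_disc :: "'c set \<Rightarrow> 'c item list \<Rightarrow> int" where
  "half_disc C xs = \<lceil>real_of_int (max_disc C xs) / 2\<rceil>"

text \<open>
  \<open>baf_choice C xs p c d\<close>: after the items \<open>xs\<close> have been packed as \<open>p\<close>, BAF may put an incoming
  item of color \<open>c\<close> into bin \<open>d\<close>. All ties, including which of the two frequent colors is called
  \<open>b\<close> and which \<open>w\<close>, may be broken arbitrarily.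
\<close>

definition baf_choice :: "'c set \<Rightarrow> 'c item list \<Rightarrow> nat list \<Rightarrow> 'c \<Rightarrow> nat \<Rightarrow> bool" where
  "baf_choice C xs p c d \<longleftrightarrow>
    (if p = [] \<or> set p = c_bins xs p c then d \<notin> set p
     else if \<forall>b\<in>C. \<forall>w\<in>C. int (num_c_bins xs p b) > half_disc C xs \<and> int (num_c_bins xs p w) > half_disc C xs \<longrightarrow> b = w
     then \<exists>c'\<in>C. c' \<noteq> c \<and> (\<forall>e\<in>C. e \<noteq> c \<longrightarrow> num_c_bins xs p e \<le> num_c_bins xs p c') \<and> d \<in> c_bins xs p c'
     else \<exists>b\<in>C. \<exists>w\<in>C. b \<noteq> w \<and> int (num_c_bins xs p b) > half_disc C xs \<and> int (num_c_bins xs p w) > half_disc C xs \<and>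
       d \<in> (if c = w then c_bins xs p b
             else if c = b then c_bins xs p w
             else if int (num_c_bins xs p b) - half_disc C xs < cur_disc xs b then c_bins xs p w
             else c_bins xs p b))"

text \<open>\<open>baf C xs p\<close>: the packing \<open>p\<close> is a possible outcome of BAF on the sequence \<open>xs\<close>.\<close>

inductive baf :: "'c set \<Rightarrow> 'c item list \<Rightarrow> nat list \<Rightarrow> bool" for C where
  baf_Nil: "baf C [] []"
| baf_snoc: "baf C xs p \<Longrightarrow> baf_choice C xs p (color x) d \<Longrightarrow> baf C (xs @ [x]) (p @ [d])"

text \<open>
  Asymptotic competitiveness, as usual for bin packing, with an additive constant that is uniform
  in the color set, for algorithms whose outcome need not be unique.
\<close>

definition competitive ::
    "real \<Rightarrow> ('c set \<Rightarrow> 'c item list \<Rightarrow> bool) \<Rightarrow> ('c set \<Rightarrow> 'c item list \<Rightarrow> nat list \<Rightarrow> bool) \<Rightarrow> bool" where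
  "competitive r inputs alg \<longleftrightarrow>
     (\<exists>K. \<forall>C xs p. inputs C xs \<longrightarrow> alg C xs p \<longrightarrow> real (num_bins p) \<le> r * real (opt xs) + K)"

lemma baf_length: "baf C xs p \<Longrightarrow> length p = length xs"
  by (induction rule: baf.induct) auto

lemma bin_content_snoc:
  "length p = length xs \<Longrightarrow>
   bin_content (xs @ [x]) (p @ [d]) b = bin_content xs p b @ (if d = b then [x] else [])"
  by (simp add: bin_content_def)

lemma bin_content_eq_Nil:
  assumes "length p = length xs"
  shows "bin_content xs p b = [] \<longleftrightarrow> b \<notin> set p"
proof -
  have "set p = snd ` set (zip xs p)"
    using assms by (metis list.set_map map_snd_zip)
  then show ?thesis
    by (force simp: bin_content_def filter_empty_conv)
qed

lemma set_bin_content: "set (bin_content xs p b) \<subseteq> set xs"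
  by (auto simp: bin_content_def dest: set_zip_leftD)

lemma baf_choice_new_or_other:
  assumes "baf_choice C xs p c d"
  shows "d \<notin> set p \<or> color (top_item xs p d) \<noteq> c"
  using assms unfolding baf_choice_def c_bins_def by (auto split: if_splits)

text \<open>BAF never gets stuck, and on zero-size items all its outcomes are valid packings.\<close>

lemma baf_total:
  assumes "cbp_input C xs"
  shows "\<exists>p. baf C xs p"
  using assms
proof (induction xs rule: rev_induct)
  case Nil
  then show ?case by (auto intro: baf.intros)
next
  case (snoc x xs)
  then have inp: "cbp_input C xs" and finC: "finite C"
    by (auto simp: cbp_input_def)
  with snoc.IH obtain p where p: "baf C xs p" by blast
  note len = baf_length[OF p]
  let ?c = "color x"
  have "\<exists>d. baf_choice C xs p ?c d"
  proof (cases "p = [] \<or> set p = c_bins xs p ?c")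
    case True
    then show ?thesis
      using ex_new_if_finite[of "set p"] by (auto simp: baf_choice_def)
  next
    case new: False
    then obtain d0 where d0: "d0 \<in> set p" "color (top_item xs p d0) \<noteq> ?c"
      by (auto simp: c_bins_def)
    then have "bin_content xs p d0 \<noteq> []"
      using bin_content_eq_Nil[OF len] by blast
    then have "top_item xs p d0 \<in> set xs"
      using set_bin_content[of xs p d0] last_in_set unfolding top_item_def by blast
    then have e0: "color (top_item xs p d0) \<in> C - {?c}"
      using inp d0 by (auto simp: cbp_input_def)
    have nonempty: "c_bins xs p e \<noteq> {}" if "0 < num_c_bins xs p e" for e
      using that by (auto simp: num_c_bins_def)
    have N0: "0 < num_c_bins xs p (color (top_item xs p d0))"
      using d0 by (auto simp: num_c_bins_def c_bins_def card_gt_0_iff)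
    show ?thesis
    proof (cases "\<forall>b\<in>C. \<forall>w\<in>C. int (num_c_bins xs p b) > half_disc C xs \<and>
        int (num_c_bins xs p w) > half_disc C xs \<longrightarrow> b = w")
      case True
      have "Max (num_c_bins xs p ` (C - {?c})) \<in> num_c_bins xs p ` (C - {?c})"
        using finC e0 by (intro Max_in) auto
      then obtain c' where c': "c' \<in> C - {?c}" "num_c_bins xs p c' = Max (num_c_bins xs p ` (C - {?c}))"
        by force
      have le: "num_c_bins xs p e \<le> num_c_bins xs p c'" if "e \<in> C" "e \<noteq> ?c" for e
        using c' finC that by simp
      have "0 < num_c_bins xs p c'"
        using N0 le[of "color (top_item xs p d0)"] e0 by simp
      then obtain d where "d \<in> c_bins xs p c'"
        using nonempty by blast
      then have "baf_choice C xs p ?c d"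
        unfolding baf_choice_def if_not_P[OF new] if_P[OF True] using c' le by blast
      then show ?thesis by blast
    next
      case False
      then obtain b w where bw: "b \<in> C" "w \<in> C" "b \<noteq> w"
          "int (num_c_bins xs p b) > half_disc C xs" "int (num_c_bins xs p w) > half_disc C xs"
        by blast
      obtain y ys where "xs = y # ys"
        using new len by (cases xs) auto
      then have ne: "0 < length xs" and y: "color (xs ! 0) \<in> C"
        using inp by (auto simp: cbp_input_def)
      let ?S = "{(\<Sum>l=i..j. disc_sign xs c l) | c i j. c \<in> C \<and> i \<le> j \<and> j < length xs}"
      have "?S \<subseteq> (\<lambda>(c, i, j). \<Sum>l=i..j. disc_sign xs c l) ` (C \<times> {..<length xs} \<times> {..<length xs})"
        by force
      then have "finite ?S"
        using finC by (meson finite_SigmaI finite_imageI finite_lessThan finite_subset)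
      moreover have "(\<Sum>l=0..0. disc_sign xs (color (xs ! 0)) l) \<in> ?S"
        using ne y by blast
      ultimately have "max_disc C xs \<ge> (\<Sum>l=0..0. disc_sign xs (color (xs ! 0)) l)"
        unfolding max_disc_def by (rule Max_ge)
      then have "max_disc C xs \<ge> 1"
        by (simp add: disc_sign_def)
      then have "half_disc C xs > 0"
        by (simp add: half_disc_def)
      then have "0 < num_c_bins xs p b" "0 < num_c_bins xs p w"
        using bw by linarith+
      then obtain db dw where "db \<in> c_bins xs p b" "dw \<in> c_bins xs p w"
        using nonempty by blast
      then have "\<exists>d. d \<in> (if ?c = w then c_bins xs p b
             else if ?c = b then c_bins xs p w
             else if int (num_c_bins xs p b) - half_disc C xs < cur_disc xs b then c_bins xs p w
             else c_bins xs p b)"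
        by auto
      then show ?thesis
        unfolding baf_choice_def if_not_P[OF new] if_not_P[OF False] using bw by blast
    qed
  qed
  then show ?case
    using p by (blast intro: baf.intros)
qed

lemma baf_valid:
  assumes "baf C xs p" "\<forall>x\<in>set xs. item_size x = 0"
  shows "valid_packing xs p"
  using assms
proof (induction rule: baf.induct)
  case baf_Nil
  then show ?case by (simp add: valid_packing_def)
next
  case (baf_snoc xs p x d)
  then have len: "length p = length xs" and IH: "valid_packing xs p" and x: "item_size x = 0"
    by (auto dest: baf_length)
  have emp: "bin_content xs p d = []" if "d \<notin> set p"
    using that bin_content_eq_Nil[OF len] by blast
  have other: "d \<in> set p \<Longrightarrow> color (last (bin_content xs p d)) \<noteq> color x"
    using baf_choice_new_or_other[OF baf_snoc.hyps(2)] by (auto simp: top_item_def)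
  show ?case
    using IH x emp other len
    by (cases "d \<in> set p") (auto simp: valid_packing_def bin_content_snoc successively_append_iff)
qed

end

theory Submission
  imports Defs
begin

text \<open>
  Write \<open>h = \<lceil>D/2\<rceil>\<close>, \<open>M\<close> for the number of bins and \<open>a c = N c - h\<close>. BAF maintains \<open>a c \<le> CD c\<close> for
  every color: a new bin is opened only if all bins are \<open>c\<close>-bins, and then the number of bins is
  \<open>N c \<le> h + CD c \<le> h + D = \<lceil>1.5 D\<rceil>\<close>. The bound \<open>a c \<le> CD c\<close> is threatened only if an item of a third
  color arrives while \<open>a b = CD b > 0\<close> and \<open>a w = CD w > 0\<close> for two colors. This is excluded by
  the second invariant \<open>2 (a b + a w) \<le> CD b + CD w + 1\<close> for \<open>b \<noteq> w\<close>. It is preserved because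
  \<open>M \<le> D + h\<close> gives \<open>a x + a y + a z \<le> D - 2 h \<le> 0\<close> for any three distinct colors.
  Finally \<open>D \<le> OPT\<close>, because in every valid packing the number of \<open>c\<close>-bins grows with each \<open>c\<close>-item
  and shrinks by at most one with each other item, so it dominates every suffix sum for \<open>c\<close>.
\<close>

section \<open>Preservation of the invariant by one step, with abstract counts\<close>

text \<open>The argument \<open>K\<close> stands for the current discrepancies \<open>CD\<close>.\<close>

definition balanced :: "'c set \<Rightarrow> int \<Rightarrow> int \<Rightarrow> int \<Rightarrow> ('c \<Rightarrow> int) \<Rightarrow> ('c \<Rightarrow> int) \<Rightarrow> bool" where
  "balanced C D h M N K \<longleftrightarrow> M \<le> D + h \<and> (\<forall>c\<in>C. N c - h \<le> K c) \<and>
     (\<forall>b\<in>C. \<forall>w\<in>C. b \<noteq> w \<longrightarrow> 2 * (N b + N w - 2 * h) \<le> K b + K w + 1)"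

definition shift_count :: "('c \<Rightarrow> int) \<Rightarrow> 'c \<Rightarrow> 'c \<Rightarrow> 'c \<Rightarrow> int" where
  "shift_count N c c' = N(c := N c + 1, c' := N c' - 1)"

definition update_disc :: "('c \<Rightarrow> int) \<Rightarrow> 'c \<Rightarrow> 'c \<Rightarrow> int" where
  "update_disc K c = (\<lambda>x. if x = c then K x + 1 else max 0 (K x - 1))"

text \<open>\<open>D\<close> and \<open>h\<close> occur only where larger values weaken the bounds.
  A step that opens no bin can thus be treated with the values from before the item.\<close>

lemma balanced_mono:
  assumes "balanced C D h M N K" "D \<le> D'" "h \<le> h'"
  shows "balanced C D' h' M N K"
  using assms unfolding balanced_def by force

text \<open>Put \<open>a x = N x - h\<close>. If also \<open>a w \<ge> K w\<close>, the pair bound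
  gives \<open>2 * (a b + a w) \<le> a b + a w + 1\<close>, hence \<open>a b + a w \<le> 1\<close>,
  although both are at least 1.\<close>

lemma balanced_slack:
  assumes "balanced C D h M N K" "b \<in> C" "w \<in> C" "b \<noteq> w" "N b > h" "N w > h" "\<not> N b - h < K b"
  shows "N w - h < K w"
proof -
  have "2 * (N b + N w - 2 * h) \<le> K b + K w + 1"
    using assms unfolding balanced_def by blast
  then show ?thesis
    using assms(5-) by presburger
qed

text \<open>The number of bins is \<open>N c\<close>, so the bound for the single color
  \<open>c\<close> also controls the total. In a pair with \<open>c\<close> the other color has no
  bins, so the left side is at most \<open>2 * (K c + 1) - 2 * h'\<close>, and
  \<open>K c + 1 \<le> D' \<le> 2 * h'\<close> turns this into at most
  \<open>K c + 1\<close>.\<close>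

lemma balanced_open:
  assumes bal: "balanced C D h (N c) N K"
    and c: "c \<in> C"
    and others: "\<forall>x. x \<noteq> c \<longrightarrow> N x = 0"
    and D: "D \<le> D'" "0 \<le> h" "h \<le> h'" "D' \<le> 2 * h'" "K c + 1 \<le> D'"
  shows "balanced C D' h' (N c + 1) (N(c := N c + 1)) (update_disc K c)"
proof -
  have Kc: "N c - h \<le> K c"
    using bal c by (simp add: balanced_def)
  have "2 * ((N(c := N c + 1)) b + (N(c := N c + 1)) w - 2 * h')
      \<le> update_disc K c b + update_disc K c w + 1" if "b \<noteq> w" for b w
    using that Kc D others by (cases "b = c"; cases "w = c") (auto simp: update_disc_def)
  then show ?thesis
    using Kc D others by (auto simp: balanced_def update_disc_def)
qed

text \<open>Rule (2) of BAF.\<close>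

lemma balanced_shift_to_max:
  assumes bal: "balanced C D h M N K"
    and c: "c \<in> C" "c' \<in> C" "c' \<noteq> c" and D: "D \<le> 2 * h"
    and triple: "\<And>x y z. x \<noteq> y \<Longrightarrow> x \<noteq> z \<Longrightarrow> y \<noteq> z \<Longrightarrow> N x + N y + N z \<le> M"
    and c'_max: "\<forall>x\<in>C. x \<noteq> c \<longrightarrow> N x \<le> N c'"
    and unique: "\<forall>b\<in>C. \<forall>w\<in>C. N b > h \<and> N w > h \<longrightarrow> b = w"
  shows "balanced C D h M (shift_count N c c') (update_disc K c)"
proof -
  let ?N = "shift_count N c c'" and ?K = "update_disc K c"
  note defs = shift_count_def update_disc_def
  have M: "M \<le> D + h" and one: "\<And>x. x \<in> C \<Longrightarrow> N x - h \<le> K x"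
    and two: "\<And>b w. b \<in> C \<Longrightarrow> w \<in> C \<Longrightarrow> b \<noteq> w \<Longrightarrow> 2 * (N b + N w - 2 * h) \<le> K b + K w + 1"
    using bal by (auto simp: balanced_def)
  \<comment> \<open>If \<open>N x > h\<close>, then \<open>N c' > h\<close> by maximality of
    \<open>c'\<close>, and \<open>unique\<close> forces \<open>x = c'\<close>.\<close>
  have low: "N x \<le> h" if "x \<in> C" "x \<noteq> c" "x \<noteq> c'" for x
    using that unique c c'_max by force
  have one': "?N x - h \<le> ?K x" if "x \<in> C" for x
    using one[OF that] low[OF that] c by (auto simp: defs)
  have with_c: "2 * (?N c + ?N w - 2 * h) \<le> ?K c + ?K w + 1" if w: "w \<in> C" "w \<noteq> c" for w
  proof (cases "w = c'")
    case True
    then show ?thesis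
      using two[of c w] c w by (auto simp: defs)
  next
    case False
    \<comment> \<open>With \<open>a x = N x - h\<close> this says
      \<open>a c + a c' + a w \<le> 0\<close>. Since \<open>a w \<le> a c'\<close>, it follows that
      \<open>2 * (a c + a w) \<le> a c \<le> K c\<close>.\<close>
    have "N c + N c' + N w \<le> 3 * h"
      using triple[of c c' w] False w c M D by simp
    then show ?thesis
      using False w c c'_max one[of c] by (auto simp: defs)
  qed
  \<comment> \<open>If \<open>c'\<close> is in the pair, the left side drops by 2 and the right side
    by at most 2. Otherwise both counts are at most \<open>h\<close> by \<open>low\<close>.\<close>
  have without_c: "2 * (?N b + ?N w - 2 * h) \<le> ?K b + ?K w + 1"
    if bw: "b \<in> C" "w \<in> C" "b \<noteq> w" "b \<noteq> c" "w \<noteq> c" for b w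
    using two[of b w] low[of b] low[of w] bw c by (auto simp: defs)
  have "2 * (?N b + ?N w - 2 * h) \<le> ?K b + ?K w + 1"
    if bw: "b \<in> C" "w \<in> C" "b \<noteq> w" for b w
    using with_c[of b] with_c[of w] without_c[of b w] bw
    by (cases "b = c"; cases "w = c") (auto simp: add.commute)
  then show ?thesis
    using M one' by (simp add: balanced_def)
qed

text \<open>Rule (3) of BAF: \<open>u\<close> is the frequent color that is covered and
  \<open>v\<close> the other one. If \<open>c \<noteq> v\<close>, then \<open>N v\<close> stays
  while \<open>K v\<close> may fall, and \<open>slack\<close> pays for that.\<close>

lemma balanced_shift_frequent:
  assumes bal: "balanced C D h M N K"
    and c: "c \<in> C" "u \<in> C" "v \<in> C" "u \<noteq> v" "c \<noteq> u" and K: "\<forall>x\<in>C. 0 \<le> K x" and D: "D \<le> 2 * h"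
    and triple: "\<And>x y z. x \<noteq> y \<Longrightarrow> x \<noteq> z \<Longrightarrow> y \<noteq> z \<Longrightarrow> N x + N y + N z \<le> M"
    and frequent: "N u > h" "N v > h"
    and slack: "c \<noteq> v \<Longrightarrow> N v - h < K v"
  shows "balanced C D h M (shift_count N c u) (update_disc K c)"
proof -
  let ?N = "shift_count N c u" and ?K = "update_disc K c"
  note defs = shift_count_def update_disc_def
  have M: "M \<le> D + h" and one: "\<And>x. x \<in> C \<Longrightarrow> N x - h \<le> K x"
    and two: "\<And>b w. b \<in> C \<Longrightarrow> w \<in> C \<Longrightarrow> b \<noteq> w \<Longrightarrow> 2 * (N b + N w - 2 * h) \<le> K b + K w + 1"
    using bal by (auto simp: balanced_def)
  \<comment> \<open>As \<open>N u\<close> and \<open>N v\<close> are at least \<open>h + 1\<close>,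
    a third color has at most \<open>h - 2\<close> bins.\<close>
  have low: "N u + N v + N x \<le> 3 * h" if "x \<noteq> u" "x \<noteq> v" for x
    using triple[of u v x] that c M D by simp
  have K_nonneg: "0 \<le> ?K x" if "x \<in> C" for x
    using that K by (auto simp: defs)
  have one': "?N x - h \<le> ?K x" if "x \<in> C" for x
    using one[OF that] low[of x] frequent slack c by (cases "x = v") (auto simp: defs)
  have uv: "2 * (?N u + ?N v - 2 * h) \<le> ?K u + ?K v + 1"
    using two[of u v] c by (auto simp: defs)
  \<comment> \<open>The critical case is \<open>y = v\<close>: before the step
    \<open>N x + N v \<le> 2 * h - 1\<close>, and the item adds at most one to this sum. Every pair
    other than \<open>{u, v}\<close> contains such an \<open>x\<close>.\<close>
  have rest: "?N x + ?N y \<le> 2 * h" if "x \<noteq> u" "x \<noteq> v" "x \<noteq> y" for x y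
    using low[of x] low[of y] that frequent c by (cases "y = v") (auto simp: defs)
  have "2 * (?N b + ?N w - 2 * h) \<le> ?K b + ?K w + 1"
    if bw: "b \<in> C" "w \<in> C" "b \<noteq> w" for b w
  proof (cases "{b, w} = {u, v}")
    case True
    then show ?thesis
      using uv by (auto simp: doubleton_eq_iff add.commute)
  next
    case False
    then have "?N b + ?N w \<le> 2 * h"
      using rest[of b w] rest[of w b] bw by (auto simp: add.commute)
    then show ?thesis
      using K_nonneg[of b] K_nonneg[of w] bw by simp
  qed
  then show ?thesis
    using M one' by (simp add: balanced_def)
qed

section \<open>How one packed item changes the numbers of \<open>c\<close>-bins\<close>

lemma c_bins_snoc:
  assumes "length p = length xs"
  shows "c_bins (xs @ [x]) (p @ [d]) e =
    (if color x = e then insert d (c_bins xs p e) else c_bins xs p e - {d})"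
  using assms by (auto simp: c_bins_def top_item_def bin_content_snoc)

lemma finite_c_bins [simp]: "finite (c_bins xs p c)"
  by (simp add: c_bins_def)

lemma num_c_bins_snoc_shift:
  assumes "length p = length xs" "d \<in> c_bins xs p c'" "c' \<noteq> color x"
  shows "(\<lambda>e. int (num_c_bins (xs @ [x]) (p @ [d]) e)) =
    shift_count (\<lambda>e. int (num_c_bins xs p e)) (color x) c'"
proof
  fix e
  have mem: "d \<in> c_bins xs p e \<longleftrightarrow> e = c'" for e
    using assms(2) by (auto simp: c_bins_def)
  have "card (c_bins xs p c') > 0"
    using assms(2) by (auto simp: card_gt_0_iff)
  then show "int (num_c_bins (xs @ [x]) (p @ [d]) e) =
      shift_count (\<lambda>e. int (num_c_bins xs p e)) (color x) c' e"
    using assms(3) mem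
    by (auto simp: num_c_bins_def c_bins_snoc[OF assms(1)] shift_count_def card_Diff_singleton)
qed

lemma num_c_bins_snoc_new:
  assumes "length p = length xs" "d \<notin> set p"
  shows "(\<lambda>e. int (num_c_bins (xs @ [x]) (p @ [d]) e)) =
    (\<lambda>e. int (num_c_bins xs p e))(color x := int (num_c_bins xs p (color x)) + 1)"
  using assms by (auto simp: fun_eq_iff num_c_bins_def c_bins_snoc[OF assms(1)])
    (auto simp: c_bins_def)

lemma num_c_bins_triple:
  assumes "x \<noteq> y" "x \<noteq> z" "y \<noteq> z"
  shows "num_c_bins xs p x + num_c_bins xs p y + num_c_bins xs p z \<le> num_bins p"
proof -
  have "card (c_bins xs p x \<union> c_bins xs p y \<union> c_bins xs p z) =
      num_c_bins xs p x + num_c_bins xs p y + num_c_bins xs p z"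
    unfolding num_c_bins_def using assms
    by (subst card_Un_disjoint; (subst card_Un_disjoint)?) (auto simp: c_bins_def)
  moreover have "card (c_bins xs p x \<union> c_bins xs p y \<union> c_bins xs p z) \<le> num_bins p"
    unfolding num_bins_def by (intro card_mono) (auto simp: c_bins_def)
  ultimately show ?thesis by simp
qed

section \<open>Current and maximal discrepancy as items arrive\<close>

lemma disc_sign_snoc:
  "disc_sign (xs @ [x]) c l = (if l < length xs then disc_sign xs c l
     else disc_sign [x] c (l - length xs))"
  by (auto simp: disc_sign_def nth_append)

lemma suffix_disc_snoc:
  assumes "i \<le> length xs"
  shows "(\<Sum>l=i..<length (xs @ [x]). disc_sign (xs @ [x]) c l) =
    (\<Sum>l=i..<length xs. disc_sign xs c l) + (if color x = c then 1 else -1)"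
proof -
  have "(\<Sum>l=i..<length xs. disc_sign (xs @ [x]) c l) = (\<Sum>l=i..<length xs. disc_sign xs c l)"
    by (intro sum.cong) (auto simp: disc_sign_snoc)
  then show ?thesis
    using assms by (simp add: disc_sign_def)
qed

lemma cur_disc_Nil [simp]: "cur_disc [] c = 0"
  by (simp add: cur_disc_def)

text \<open>Kadane's recurrence for the maximal suffix sum: the new item shifts all old suffix sums
  by the same sign, and the empty suffix contributes 0.\<close>

lemma cur_disc_snoc:
  "cur_disc (xs @ [x]) c = max 0 (cur_disc xs c + (if color x = c then 1 else -1))"
proof -
  define S where "S xs = (\<lambda>i. \<Sum>l=i..<length xs. disc_sign xs c l) ` {..length xs}" for xs
  have cd: "cur_disc xs c = Max (S xs)" for xs
    unfolding cur_disc_def S_def by (rule arg_cong[of _ _ Max]) auto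
  let ?s = "if color x = c then 1 else - 1 :: int"
  have "{..length (xs @ [x])} = insert (length (xs @ [x])) {..length xs}"
    by auto
  then have "S (xs @ [x]) = insert 0 ((\<lambda>i. (\<Sum>l=i..<length xs. disc_sign xs c l) + ?s) ` {..length xs})"
    unfolding S_def by (simp only: image_insert) (auto simp: suffix_disc_snoc simp del: length_append)
  then have S: "S (xs @ [x]) = insert 0 ((\<lambda>t. t + ?s) ` S xs)"
    by (simp add: S_def image_image)
  moreover have "Max ((\<lambda>t. t + ?s) ` S xs) = Max (S xs) + ?s"
    by (rule mono_Max_commute[symmetric]) (auto simp: S_def mono_def)
  ultimately show ?thesis
    unfolding cd by (subst S, subst Max_insert) (auto simp: S_def)
qed

lemma cur_disc_nonneg: "0 \<le> cur_disc xs c"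
  by (induction xs rule: rev_induct) (auto simp: cur_disc_snoc)

lemma cur_disc_snoc_update: "cur_disc (xs @ [x]) = update_disc (cur_disc xs) (color x)"
  using cur_disc_nonneg[of xs] by (auto simp: fun_eq_iff cur_disc_snoc update_disc_def)

definition disc_set :: "'c set \<Rightarrow> 'c item list \<Rightarrow> int set" where
  "disc_set C xs = {(\<Sum>l=i..j. disc_sign xs c l) | c i j. c \<in> C \<and> i \<le> j \<and> j < length xs}"

lemma max_disc_eq: "max_disc C xs = Max (disc_set C xs)"
  by (simp add: max_disc_def disc_set_def)

lemma finite_disc_set:
  assumes "finite C"
  shows "finite (disc_set C xs)"
proof -
  have "disc_set C xs \<subseteq>
      (\<lambda>(c, i, j). \<Sum>l=i..j. disc_sign xs c l) ` (C \<times> {..<length xs} \<times> {..<length xs})"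
    by (force simp: disc_set_def)
  then show ?thesis
    using assms by (meson finite_SigmaI finite_imageI finite_lessThan finite_subset)
qed

lemma disc_set_snoc_subset: "disc_set C xs \<subseteq> disc_set C (xs @ [x])"
proof
  fix s assume "s \<in> disc_set C xs"
  then obtain c i j where s: "s = (\<Sum>l=i..j. disc_sign xs c l)" "c \<in> C" "i \<le> j" "j < length xs"
    by (auto simp: disc_set_def)
  then have "s = (\<Sum>l=i..j. disc_sign (xs @ [x]) c l)"
    by (auto simp: disc_sign_snoc intro!: sum.cong)
  then show "s \<in> disc_set C (xs @ [x])"
    using s by (force simp: disc_set_def)
qed

lemma disc_set_nonempty:
  assumes "xs \<noteq> []" "C \<noteq> {}"
  shows "disc_set C xs \<noteq> {}"
proof -
  obtain c where "c \<in> C"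
    using assms by blast
  then have "(\<Sum>l=0..0. disc_sign xs c l) \<in> disc_set C xs"
    unfolding disc_set_def using assms(1) by blast
  then show ?thesis by blast
qed

text \<open>The value at the empty sequence makes the first item an ordinary step of BAF.\<close>

definition disc :: "'c set \<Rightarrow> 'c item list \<Rightarrow> int" where
  "disc C xs = (if xs = [] then 0 else max_disc C xs)"

lemma disc_nonneg:
  assumes "finite C" "color ` set xs \<subseteq> C"
  shows "0 \<le> disc C xs"
proof (cases xs)
  case (Cons y ys)
  then have "color y \<in> C"
    using assms by auto
  then have "(\<Sum>l=0..0. disc_sign xs (color y) l) \<in> disc_set C xs"
    unfolding disc_set_def using Cons by blast
  then show ?thesis
    using Max_ge[OF finite_disc_set[OF assms(1)], of _ xs] Cons
    by (fastforce simp: disc_def max_disc_eq disc_sign_def)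
qed (simp add: disc_def)

lemma disc_snoc_mono:
  assumes "finite C" "color ` set (xs @ [x]) \<subseteq> C"
  shows "disc C xs \<le> disc C (xs @ [x])"
proof (cases "xs = []")
  case True
  then show ?thesis
    using disc_nonneg[OF assms] by (simp add: disc_def)
next
  case False
  then show ?thesis
    using assms disc_set_nonempty[OF False, of C]
    by (auto simp: disc_def max_disc_eq intro!: Max_mono disc_set_snoc_subset finite_disc_set)
qed

lemma cur_disc_le_disc:
  assumes "finite C" "color ` set xs \<subseteq> C" "c \<in> C"
  shows "cur_disc xs c \<le> disc C xs"
proof -
  have "(\<Sum>l=i..<length xs. disc_sign xs c l) \<le> disc C xs" if "i \<le> length xs" for i
  proof (cases "i = length xs")
    case True
    then show ?thesis
      using disc_nonneg[OF assms(1,2)] by simp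
  next
    case False
    then have "{i..<length xs} = {i..length xs - 1}" "i \<le> length xs - 1" "length xs - 1 < length xs"
      using that by auto
    then have "(\<Sum>l=i..<length xs. disc_sign xs c l) \<in> disc_set C xs"
      unfolding disc_set_def using assms(3) by fastforce
    then show ?thesis
      using Max_ge[OF finite_disc_set[OF assms(1)]] False that
      by (auto simp: disc_def max_disc_eq)
  qed
  moreover have "{(\<Sum>l=i..<length xs. disc_sign xs c l) | i. i \<le> length xs} =
      (\<lambda>i. \<Sum>l=i..<length xs. disc_sign xs c l) ` {..length xs}"
    by auto
  ultimately show ?thesis
    unfolding cur_disc_def by auto
qed

section \<open>The maximal discrepancy as a lower bound on the optimum\<close>

text \<open>Only the color condition of validity is kept, for all bin names, so that passing to a
  prefix needs no care about sizes or about which bins are in use.\<close>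

definition alternating :: "'c item list \<Rightarrow> nat list \<Rightarrow> bool" where
  "alternating xs p \<longleftrightarrow> length p = length xs \<and>
     (\<forall>b. successively (\<lambda>x y. color x \<noteq> color y) (bin_content xs p b))"

lemma valid_packing_alternating:
  assumes "valid_packing xs p"
  shows "alternating xs p"
  unfolding alternating_def
proof (intro conjI allI)
  show len: "length p = length xs"
    using assms by (simp add: valid_packing_def)
  show "successively (\<lambda>x y. color x \<noteq> color y) (bin_content xs p b)" for b
    using assms bin_content_eq_Nil[OF len, of b]
    by (cases "b \<in> set p") (auto simp: valid_packing_def)
qed

lemma alternating_snocD:
  assumes "alternating (xs @ [x]) (p @ [d])"
  shows "alternating xs p" "d \<notin> c_bins xs p (color x)"
proof -
  have len: "length p = length xs"
    using assms by (simp add: alternating_def)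
  have succ: "successively (\<lambda>x y. color x \<noteq> color y) (bin_content xs p b @ (if d = b then [x] else []))" for b
    using assms by (simp add: alternating_def bin_content_snoc[OF len, symmetric])
  show "alternating xs p"
    using succ len by (auto simp: alternating_def successively_append_iff)
  show "d \<notin> c_bins xs p (color x)"
    using succ[of d] bin_content_eq_Nil[OF len, of d]
    by (auto simp: c_bins_def top_item_def successively_append_iff)
qed

text \<open>The induction removes the last item with \<open>i\<close> fixed and ends at the empty
  suffix. A \<open>c\<close>-item cannot land on a \<open>c\<close>-bin, so it always creates a new
  one.\<close>

lemma suffix_disc_le_num_c_bins:
  assumes "alternating xs p" "i \<le> length xs"
  shows "(\<Sum>l=i..<length xs. disc_sign xs c l) \<le> int (num_c_bins xs p c)"
  using assms
proof (induction xs arbitrary: p rule: rev_induct)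
  case Nil
  then show ?case by simp
next
  case (snoc x xs)
  show ?case
  proof (cases "i = length (xs @ [x])")
    case False
    then have i: "i \<le> length xs"
      using snoc.prems by simp
    obtain q d where p: "p = q @ [d]" "length q = length xs"
      using snoc.prems(1) by (cases p rule: rev_cases) (auto simp: alternating_def)
    note alt = alternating_snocD[OF snoc.prems(1)[unfolded p(1)]]
    have "card (c_bins xs q c) \<le> card (c_bins xs q c - {d}) + 1"
      using diff_card_le_card_Diff[of "{d}" "c_bins xs q c"] by simp
    then show ?thesis
      using snoc.IH[OF alt(1) i] alt(2) suffix_disc_snoc[OF i, of x c]
      by (auto simp: p num_c_bins_def c_bins_snoc simp del: length_append split: if_splits)
  qed simp
qed

text \<open>Removing the items after \<open>j\<close> turns the interval into a suffix and never
  increases the number of bins.\<close>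

lemma interval_disc_le_num_bins:
  assumes "alternating xs p" "i \<le> j" "j < length xs"
  shows "(\<Sum>l=i..j. disc_sign xs c l) \<le> int (num_bins p)"
  using assms
proof (induction xs arbitrary: p rule: rev_induct)
  case Nil
  then show ?case by simp
next
  case (snoc x xs)
  obtain q d where p: "p = q @ [d]"
    using snoc.prems(1) by (cases p rule: rev_cases) (auto simp: alternating_def)
  show ?case
  proof (cases "j < length xs")
    case True
    then have "(\<Sum>l=i..j. disc_sign (xs @ [x]) c l) = (\<Sum>l=i..j. disc_sign xs c l)"
      by (intro sum.cong) (auto simp: disc_sign_snoc)
    also have "\<dots> \<le> int (num_bins q)"
      using snoc True alternating_snocD(1) p by blast
    also have "\<dots> \<le> int (num_bins p)"
      by (auto simp: num_bins_def p intro: card_mono)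
    finally show ?thesis .
  next
    case False
    then have "{i..j} = {i..<length (xs @ [x])}"
      using snoc.prems by auto
    then have "(\<Sum>l=i..j. disc_sign (xs @ [x]) c l) \<le> int (num_c_bins (xs @ [x]) p c)"
      using suffix_disc_le_num_c_bins[OF snoc.prems(1), of i c] snoc.prems by simp
    also have "\<dots> \<le> int (num_bins p)"
      by (auto simp: num_c_bins_def num_bins_def c_bins_def intro!: card_mono)
    finally show ?thesis .
  qed
qed

lemma disc_le_num_bins:
  assumes "finite C" "color ` set xs \<subseteq> C" "valid_packing xs p"
  shows "disc C xs \<le> int (num_bins p)"
proof (cases "xs = []")
  case False
  then have "C \<noteq> {}"
    using assms(2) by auto
  then show ?thesis
    using False disc_set_nonempty[of xs C] finite_disc_set[OF assms(1), of xs]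
      interval_disc_le_num_bins[OF valid_packing_alternating[OF assms(3)]]
    by (auto simp: disc_def max_disc_eq) (auto simp: disc_set_def)
qed (simp add: disc_def)

section \<open>The invariant along runs of BAF, and the bound\<close>

abbreviation half_up :: "int \<Rightarrow> int" where
  "half_up D \<equiv> \<lceil>real_of_int D / 2\<rceil>"

lemma baf_balanced:
  assumes "baf C xs p" "finite C" "color ` set xs \<subseteq> C"
  shows "balanced C (disc C xs) (half_up (disc C xs)) (int (num_bins p))
    (\<lambda>c. int (num_c_bins xs p c)) (cur_disc xs)"
  using assms
proof (induction rule: baf.induct)
  case baf_Nil
  then show ?case
    by (simp add: balanced_def disc_def num_bins_def num_c_bins_def c_bins_def)
next
  case (baf_snoc xs p x d)
  let ?c = "color x" and ?D = "disc C xs" and ?D' = "disc C (xs @ [x])"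
  let ?h = "half_up ?D" and ?h' = "half_up ?D'"
  let ?N = "\<lambda>e. int (num_c_bins xs p e)" and ?K = "cur_disc xs"
  have len: "length p = length xs"
    using baf_snoc.hyps(1) by (rule baf_length)
  have c: "?c \<in> C" and cols: "color ` set xs \<subseteq> C"
    using baf_snoc.prems by auto
  have bal: "balanced C ?D ?h (int (num_bins p)) ?N ?K"
    using baf_snoc.IH baf_snoc.prems(1) cols by blast
  have K: "\<forall>x\<in>C. 0 \<le> ?K x"
    by (simp add: cur_disc_nonneg)
  have D: "?D \<le> ?D'"
    using baf_snoc.prems by (rule disc_snoc_mono)
  then have h: "?h \<le> ?h'"
    by (intro ceiling_mono) simp
  have twice: "t \<le> 2 * half_up t" for t
    by linarith
  have triple: "?N x + ?N y + ?N z \<le> int (num_bins p)" if "x \<noteq> y" "x \<noteq> z" "y \<noteq> z" for x y z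
    using num_c_bins_triple[OF that, of xs p] by linarith
  show ?case
  proof (cases "p = [] \<or> set p = c_bins xs p ?c")
    case True
    \<comment> \<open>This includes the first item: for \<open>p = []\<close> both sets are
      empty.\<close>
    then have d: "d \<notin> set p" and all: "set p = c_bins xs p ?c"
      using baf_snoc.hyps(2) by (auto simp: baf_choice_def c_bins_def)
    have M: "int (num_bins p) = ?N ?c"
      using all by (simp add: num_bins_def num_c_bins_def)
    have others: "\<forall>e. e \<noteq> ?c \<longrightarrow> ?N e = 0"
      using all by (auto simp: num_c_bins_def c_bins_def)
    \<comment> \<open>The left side is the current discrepancy of the item's color after its
      arrival.\<close>
    have "?K ?c + 1 \<le> ?D'"
      using cur_disc_le_disc[OF baf_snoc.prems c] cur_disc_nonneg[of xs ?c]
      by (simp add: cur_disc_snoc)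
    moreover have "0 \<le> ?h"
      using disc_nonneg[OF baf_snoc.prems(1) cols] by linarith
    ultimately have "balanced C ?D' ?h' (?N ?c + 1) (?N(?c := ?N ?c + 1)) (update_disc ?K ?c)"
      using balanced_open[OF bal[unfolded M] c others D _ h twice] by blast
    moreover have "int (num_bins (p @ [d])) = ?N ?c + 1"
      using d M by (simp add: num_bins_def)
    ultimately show ?thesis
      by (simp only: num_c_bins_snoc_new[OF len d] cur_disc_snoc_update)
  next
    case nonempty: False
    \<comment> \<open>Here \<open>xs\<close> is nonempty, so the default value of
      \<open>disc\<close> does not interfere.\<close>
    then have half: "half_disc C xs = ?h"
      using len by (auto simp: half_disc_def disc_def)
    \<comment> \<open>BAF consults the old discrepancy, so the step is proved for \<open>?D\<close>
      and \<open>?h\<close>; the passage to \<open>?D'\<close> and \<open>?h'\<close> follows by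
      monotonicity.\<close>
    have "\<exists>c'. d \<in> c_bins xs p c' \<and> c' \<noteq> ?c \<and>
        balanced C ?D ?h (int (num_bins p)) (shift_count ?N ?c c') (update_disc ?K ?c)"
    proof (cases "\<forall>b\<in>C. \<forall>w\<in>C. ?N b > ?h \<and> ?N w > ?h \<longrightarrow> b = w")
      case True
      then obtain c' where c': "c' \<in> C" "c' \<noteq> ?c" "d \<in> c_bins xs p c'"
          "\<forall>e\<in>C. e \<noteq> ?c \<longrightarrow> ?N e \<le> ?N c'"
        using baf_snoc.hyps(2) unfolding baf_choice_def half if_not_P[OF nonempty] if_P[OF True]
        by auto
      then show ?thesis
        using balanced_shift_to_max[OF bal c c'(1,2) twice triple c'(4) True] by blast
    next
      case False
      then obtain b w where bw: "b \<in> C" "w \<in> C" "b \<noteq> w" "?N b > ?h" "?N w > ?h"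
        and d: "d \<in> (if ?c = w then c_bins xs p b else if ?c = b then c_bins xs p w
             else if ?N b - ?h < cur_disc xs b then c_bins xs p w else c_bins xs p b)"
        using baf_snoc.hyps(2) unfolding baf_choice_def half if_not_P[OF nonempty] if_not_P[OF False]
        by blast
      have into_b: ?thesis if "d \<in> c_bins xs p b" "?c \<noteq> b" "?c \<noteq> w \<Longrightarrow> ?N w - ?h < ?K w"
        using balanced_shift_frequent[OF bal c bw(1,2,3) that(2) K twice triple bw(4,5) that(3)] that
        by auto
      have into_w: ?thesis if "d \<in> c_bins xs p w" "?c \<noteq> w" "?c \<noteq> b \<Longrightarrow> ?N b - ?h < ?K b"
        using balanced_shift_frequent[OF bal c bw(2,1) bw(3)[symmetric] that(2) K twice triple bw(5,4) that(3)] that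
        by auto
      \<comment> \<open>When the test of rule (3) fails for \<open>b\<close>, this supplies the room
        needed at \<open>w\<close>.\<close>
      note slack = balanced_slack[OF bal bw]
      consider "?c = w" | "?c = b" | "?c \<noteq> w" "?c \<noteq> b" "?N b - ?h < ?K b"
        | "?c \<noteq> w" "?c \<noteq> b" "\<not> ?N b - ?h < ?K b"
        by blast
      then show ?thesis
      proof cases
        case 1
        then show ?thesis using into_b d bw(3) by simp
      next
        case 2
        then show ?thesis using into_w d bw(3) by simp
      next
        case 3
        then show ?thesis using into_w d by simp
      next
        case 4
        then show ?thesis using into_b d slack by simp
      qed
    qed
    then obtain c' where c': "d \<in> c_bins xs p c'" "c' \<noteq> ?c"
      and bal': "balanced C ?D ?h (int (num_bins p)) (shift_count ?N ?c c') (update_disc ?K ?c)"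
      by blast
    have "num_bins (p @ [d]) = num_bins p"
      using c'(1) by (simp add: num_bins_def c_bins_def insert_absorb)
    then show ?thesis
      using balanced_mono[OF bal' D h]
      by (simp only: num_c_bins_snoc_shift[OF len c'] cur_disc_snoc_update)
  qed
qed

lemma baf_num_bins_le:
  assumes "zero_size_input C xs" "baf C xs p"
  shows "int (num_bins p) \<le> \<lceil>1.5 * real (opt xs)\<rceil>"
proof -
  have fin: "finite C" and cols: "color ` set xs \<subseteq> C" and size: "\<forall>x\<in>set xs. item_size x = 0"
    using assms(1) by (auto simp: zero_size_input_def cbp_input_def)
  have "\<exists>q. valid_packing xs q \<and> num_bins q = opt xs"
    unfolding opt_def using baf_valid[OF assms(2) size]
    by (intro LeastI[of "\<lambda>n. \<exists>q. valid_packing xs q \<and> num_bins q = n" "num_bins p"]) blast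
  then have "disc C xs \<le> int (opt xs)"
    using disc_le_num_bins[OF fin cols] by metis
  moreover have "int (num_bins p) \<le> disc C xs + half_up (disc C xs)"
    using baf_balanced[OF assms(2) fin cols] by (simp add: balanced_def)
  \<comment> \<open>For the integer \<open>D = disc C xs\<close>,
    \<open>D + \<lceil>D/2\<rceil> = \<lceil>1.5 D\<rceil>\<close>, which is monotone in
    \<open>D\<close>.\<close>
  ultimately show ?thesis
    by linarith
qed

theorem theorem3p4:
  shows "(\<forall>(C :: 'c set) xs p. zero_size_input C xs \<longrightarrow> baf C xs p \<longrightarrow>
            int (num_bins p) \<le> \<lceil>1.5 * real (opt xs)\<rceil>) \<and>
         competitive 1.5 (zero_size_input :: 'c set \<Rightarrow> 'c item list \<Rightarrow> bool) baf"
proof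
  show le: "\<forall>(C :: 'c set) xs p. zero_size_input C xs \<longrightarrow> baf C xs p \<longrightarrow>
      int (num_bins p) \<le> \<lceil>1.5 * real (opt xs)\<rceil>"
    using baf_num_bins_le by blast
  \<comment> \<open>Rounding up costs less than one bin, so 1 serves as the additive
    constant.\<close>
  have "real (num_bins p) \<le> 1.5 * real (opt xs) + 1"
    if "zero_size_input C xs" "baf C xs p" for C :: "'c set" and xs p
    using baf_num_bins_le[OF that] by linarith
  then show "competitive 1.5 (zero_size_input :: 'c set \<Rightarrow> 'c item list \<Rightarrow> bool) baf"
    unfolding competitive_def by blast
qed

end
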